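(* Suppose $\frac{2\delta}{\mu}<\alpha$ and $M>M_\beta$. Then the function $$V(x)=\begin{cases}K_1(\alpha,\beta)\left(e^{r_+(\alpha)x}-e^{r_-(\alpha)x}\right), & 0\le x<x_\alpha,\\[1mm] V'(x_\alpha)\,\dfrac{\mu a(x)-2\delta}{2\gamma}\left(\dfrac{a(x)-c}{\alpha-c}\right)^{-\Gamma}, & x_\alpha\le x<x_\beta,\\[1mm] K_1(\beta)e^{r_+(\beta)(x-x_1)}+K_2(\beta)e^{r_-(\beta)(x-x_1)}, & x_\beta\le x<x_1,\\[1mm] \dfrac{M}{\gamma}+\dfrac{1}{\tilde r_-(\beta)}e^{\tilde r_-(\beta)(x-x_1)}, & x\ge x_1,\end{cases}$$ (with all quantities as defined in the context) is a concave, twice differentiable solution on $[0,\infty)$ of the HJB equation $$0=\max_{\alpha\le a\le\beta}\left(\tfrac12\sigma^2a^2V''(x)+(a\mu-\delta)V'(x)-\gamma V(x)+M(1-V'(x))^+\right),\qquad V(0)=0,$$ and it satisfies $0\le V(x)\le \frac{M}{\gamma}$ for all $x>0$.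
   Context: Parameters: real constants $\mu>0$, $\sigma>0$, $\gamma>0$, $\delta\ge0$, $M>0$, $0<\alpha<\beta<\infty$; $y^+=\max(y,0)$. For $z>0$: $r_\pm(z)=\dfrac{-(z\mu-\delta)\pm\sqrt{(z\mu-\delta)^2+2\gamma\sigma^2z^2}}{\sigma^2z^2}$, and $\tilde r_-(z)=\dfrac{-(z\mu-\delta-M)-\sqrt{(z\mu-\delta-M)^2+2\gamma\sigma^2z^2}}{\sigma^2z^2}$. $c=\dfrac{2\delta\mu}{\mu^2+2\gamma\sigma^2}$, $\Gamma=\dfrac{\mu^2}{\mu^2+2\gamma\sigma^2}$, $M_\beta=\left(\beta-c\right)\dfrac{\mu^2+2\gamma\sigma^2}{2\mu}$, and $G(u)=u+c\log(u-c)$ for $u>c$, with $G^{-1}$ its inverse. $x_\alpha=\dfrac{1}{r_+(\alpha)-r_-(\alpha)}\log\left(\dfrac{r_-(\alpha)(\mu+\alpha\sigma^2r_-(\alpha))}{r_+(\alpha)(\mu+\alpha\sigma^2r_+(\alpha))}\right)$, $\quad x_\beta=x_\alpha+\dfrac{\mu\sigma^2}{\mu^2+2\gamma\sigma^2}\,[G(\beta)-G(\alpha)]$. $a(x)=G^{-1}\left(\dfrac{\mu^2+2\gamma\sigma^2}{\mu\sigma^2}(x-x_\alpha)+G(\alpha)\right)$ for $x\in[x_\alpha,x_\beta]$. $K_1(\beta)=\dfrac{\tilde r_-(\beta)-r_-(\beta)}{r_+(\beta)(r_+(\beta)-r_-(\beta))}$, $\quad K_2(\beta)=\dfrac{r_+(\beta)-\tilde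 r_-(\beta)}{r_-(\beta)(r_+(\beta)-r_-(\beta))}$. $\Delta=\dfrac{1}{r_+(\beta)-r_-(\beta)}\log\left(-\dfrac{(r_+(\beta)-\tilde r_-(\beta))(\mu+\beta\sigma^2r_-(\beta))}{(\tilde r_-(\beta)-r_-(\beta))(\mu+\beta\sigma^2r_+(\beta))}\right)$, and $x_1=x_\beta-\Delta$. The constants written $V'(x_\beta)$, $V'(x_\alpha)$, $K_1(\alpha,\beta)$ are defined by $V'(x_\beta)=\beta\sigma^2e^{r_-(\beta)\Delta}\dfrac{r_+(\beta)-\tilde r_-(\beta)}{\mu+\beta\sigma^2r_+(\beta)}$, $\quad V'(x_\alpha)=V'(x_\beta)\left(\dfrac{\beta-c}{\alpha-c}\right)^{\Gamma}$, $\quad K_1(\alpha,\beta)=\dfrac{V'(x_\alpha)}{r_+(\alpha)e^{r_+(\alpha)x_\alpha}-r_-(\alpha)e^{r_-(\alpha)x_\alpha}}$. *)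

theory Defs
  imports "HOL-Analysis.Analysis"
begin

definition is_max_on :: "('a \<Rightarrow> real) \<Rightarrow> 'a set \<Rightarrow> real \<Rightarrow> bool" where
  "is_max_on f A m \<longleftrightarrow> (\<exists>a\<in>A. f a = m) \<and> (\<forall>a\<in>A. f a \<le> m)"

text \<open>
  The locale carries no assumptions; it only shortens the formulas. Outside it, each constant
  takes as arguments those of the parameters it depends on, in the order of the locale.
\<close>

locale hjb_constants =
  fixes \<mu> \<sigma> \<gamma> \<delta> M \<alpha> \<beta> :: real
begin

definition r_plus :: "real \<Rightarrow> real" where
  "r_plus z = (- (z * \<mu> - \<delta>) + sqrt ((z * \<mu> - \<delta>)\<^sup>2 + 2 * \<gamma> * \<sigma>\<^sup>2 * z\<^sup>2)) / (\<sigma>\<^sup>2 * z\<^sup>2)"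

definition r_minus :: "real \<Rightarrow> real" where
  "r_minus z = (- (z * \<mu> - \<delta>) - sqrt ((z * \<mu> - \<delta>)\<^sup>2 + 2 * \<gamma> * \<sigma>\<^sup>2 * z\<^sup>2)) / (\<sigma>\<^sup>2 * z\<^sup>2)"

definition rt_minus :: "real \<Rightarrow> real" where
  "rt_minus z =
    (- (z * \<mu> - \<delta> - M) - sqrt ((z * \<mu> - \<delta> - M)\<^sup>2 + 2 * \<gamma> * \<sigma>\<^sup>2 * z\<^sup>2)) / (\<sigma>\<^sup>2 * z\<^sup>2)"

definition c :: real where
  "c = 2 * \<delta> * \<mu> / (\<mu>\<^sup>2 + 2 * \<gamma> * \<sigma>\<^sup>2)"

definition Gam :: real where
  "Gam = \<mu>\<^sup>2 / (\<mu>\<^sup>2 + 2 * \<gamma> * \<sigma>\<^sup>2)"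

definition M_beta :: real where
  "M_beta = (\<beta> - c) * ((\<mu>\<^sup>2 + 2 * \<gamma> * \<sigma>\<^sup>2) / (2 * \<mu>))"

definition G :: "real \<Rightarrow> real" where
  "G u = u + c * ln (u - c)"

text \<open>\<open>G\<close> is meaningful only on the half-line \<open>u > c\<close>, so it is inverted there.\<close>

definition G_inv :: "real \<Rightarrow> real" where
  "G_inv = inv_into {c<..} G"

definition x_alpha :: real where
  "x_alpha = 1 / (r_plus \<alpha> - r_minus \<alpha>) *
     ln ((r_minus \<alpha> * (\<mu> + \<alpha> * \<sigma>\<^sup>2 * r_minus \<alpha>)) / (r_plus \<alpha> * (\<mu> + \<alpha> * \<sigma>\<^sup>2 * r_plus \<alpha>)))"

definition x_beta :: real where
  "x_beta = x_alpha + \<mu> * \<sigma>\<^sup>2 / (\<mu>\<^sup>2 + 2 * \<gamma> * \<sigma>\<^sup>2) * (G \<beta> - G \<alpha>)"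

definition a :: "real \<Rightarrow> real" where
  "a x = G_inv ((\<mu>\<^sup>2 + 2 * \<gamma> * \<sigma>\<^sup>2) / (\<mu> * \<sigma>\<^sup>2) * (x - x_alpha) + G \<alpha>)"

definition K1_beta :: real where
  "K1_beta = (rt_minus \<beta> - r_minus \<beta>) / (r_plus \<beta> * (r_plus \<beta> - r_minus \<beta>))"

definition K2_beta :: real where
  "K2_beta = (r_plus \<beta> - rt_minus \<beta>) / (r_minus \<beta> * (r_plus \<beta> - r_minus \<beta>))"

definition Delta :: real where
  "Delta = 1 / (r_plus \<beta> - r_minus \<beta>) *
     ln (- (((r_plus \<beta> - rt_minus \<beta>) * (\<mu> + \<beta> * \<sigma>\<^sup>2 * r_minus \<beta>)) /
            ((rt_minus \<beta> - r_minus \<beta>) * (\<mu> + \<beta> * \<sigma>\<^sup>2 * r_plus \<beta>))))"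

text \<open>\<open>Delta\<close> is negative when \<open>M > M_beta\<close>, which puts \<open>x_1\<close> to the right of \<open>x_beta\<close>.\<close>

definition x_1 :: real where
  "x_1 = x_beta - Delta"

text \<open>
  \<open>dV_beta\<close> and \<open>dV_alpha\<close> are the constants written \<open>V'(x_beta)\<close> and \<open>V'(x_alpha)\<close>: they are
  given by closed formulas, not by differentiating \<open>V\<close>.
\<close>

definition dV_beta :: real where
  "dV_beta = \<beta> * \<sigma>\<^sup>2 * exp (r_minus \<beta> * Delta) *
     ((r_plus \<beta> - rt_minus \<beta>) / (\<mu> + \<beta> * \<sigma>\<^sup>2 * r_plus \<beta>))"

definition dV_alpha :: real where
  "dV_alpha = dV_beta * ((\<beta> - c) / (\<alpha> - c)) powr Gam"

definition K1_alpha_beta :: real where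
  "K1_alpha_beta =
     dV_alpha / (r_plus \<alpha> * exp (r_plus \<alpha> * x_alpha) - r_minus \<alpha> * exp (r_minus \<alpha> * x_alpha))"

text \<open>Only the values at \<open>x \<ge> 0\<close> are meaningful.\<close>

definition V :: "real \<Rightarrow> real" where
  "V x =
    (if x < x_alpha then K1_alpha_beta * (exp (r_plus \<alpha> * x) - exp (r_minus \<alpha> * x))
     else if x < x_beta then
       dV_alpha * ((\<mu> * a x - 2 * \<delta>) / (2 * \<gamma>)) * ((a x - c) / (\<alpha> - c)) powr (- Gam)
     else if x < x_1 then
       K1_beta * exp (r_plus \<beta> * (x - x_1)) + K2_beta * exp (r_minus \<beta> * (x - x_1))
     else M / \<gamma> + 1 / rt_minus \<beta> * exp (rt_minus \<beta> * (x - x_1)))"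

end

end

theory Submission
  imports Defs
begin

text \<open>
  For fixed \<open>x\<close> the expression to be maximised is a quadratic polynomial in the control. If
  \<open>V'' < 0\<close>, its unconstrained maximiser is \<open>-\<mu> V' / (\<sigma>\<^sup>2 V'')\<close>, and its maximiser over
  \<open>[\<alpha>, \<beta>]\<close> is the projection of that point. So where \<open>b\<close> denotes the projected point, the
  sign of \<open>\<mu> V' + b \<sigma>\<^sup>2 V''\<close> is all that has to be known about \<open>V\<close>, besides the differential
  equation for the control \<open>b\<close> (\<open>concave_quadratic_le\<close>).

  The four branches of \<open>V\<close> are the regimes \<open>b = \<alpha>\<close>, \<open>b = a(x)\<close>, \<open>b = \<beta>\<close> with \<open>V' \<ge> 1\<close>, and
  \<open>b = \<beta>\<close> with \<open>V' \<le> 1\<close>. On the first and third branches \<open>V\<close> is a combination of exponentials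
  whose exponents are roots of the characteristic equation for that control. On the last branch the
  payout term lowers the drift by \<open>M\<close> and adds the constant \<open>M / \<gamma>\<close>, and only the decaying
  exponential occurs. On the second branch the formula for \<open>a\<close> gives
  \<open>\<mu> V' + a(x) \<sigma>\<^sup>2 V'' = 0\<close> identically.

  The numbers \<open>x_alpha\<close> and \<open>x_beta\<close> are precisely the points where \<open>\<mu> V' + b \<sigma>\<^sup>2 V''\<close> vanishes
  for the first and the third branch. The factors of the branches make \<open>V'\<close> match there, and the
  vanishing then makes \<open>V''\<close> match. At \<open>x_1\<close> the weights \<open>K1_beta\<close> and \<open>K2_beta\<close> give both sides
  \<open>V' = 1\<close> and \<open>V'' = rt_minus \<beta>\<close>. At all three points \<open>V\<close> matches too, since by the
  differential equation \<open>\<gamma> V\<close> is a function of the control, \<open>V'\<close> and \<open>V''\<close>. Hence \<open>V\<close> is twice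
  differentiable.

  The function \<open>P e\<^bsup>r x\<^esup> - Q e\<^bsup>s x\<^esup>\<close> is nondecreasing for \<open>P, Q \<ge> 0\<close> and \<open>r \<ge> 0 \<ge> s\<close>
  (\<open>exp_diff_mono\<close>), so the signs needed on the first and the third branch follow from the value at
  an end of the branch. The constants at these ends are compared by locating negative
  numbers relative to the negative roots (\<open>negative_root_location\<close>): \<open>-\<mu> / (z \<sigma>\<^sup>2)\<close> lies
  to the right of \<open>r_minus z\<close> if \<open>z > c\<close>, in particular for \<open>z = \<alpha>\<close> and \<open>z = \<beta>\<close>, and \<open>M > M_beta\<close>
  puts \<open>-\<mu> / (\<beta> \<sigma>\<^sup>2)\<close> to the left of \<open>rt_minus \<beta>\<close>, which gives \<open>x_beta < x_1\<close> and keeps \<open>\<beta>\<close>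
  optimal on the last branch. The hypothesis \<open>2 \<delta> / \<mu> < \<alpha>\<close> gives \<open>c < \<alpha>\<close> and \<open>x_alpha > 0\<close>.
  The bounds on \<open>V\<close> follow from \<open>V(0) = 0\<close>, \<open>V' > 0\<close> and the form of the last branch.
\<close>

section \<open>Quadratic polynomials, exponentials and gluing\<close>

text \<open>The difference of the two sides is \<open>(u - b) (p + s b q) + s q (u - b)\<^sup>2 / 2\<close>.\<close>

lemma concave_quadratic_le:
  fixes s p q b u k :: real
  assumes "s \<ge> 0" and "q \<le> 0" and "(u - b) * (p + s * b * q) \<le> 0"
  shows "1 / 2 * s * u\<^sup>2 * q + u * p + k \<le> 1 / 2 * s * b\<^sup>2 * q + b * p + k"
proof -
  have "1 / 2 * s * u\<^sup>2 * q + u * p + k - (1 / 2 * s * b\<^sup>2 * q + b * p + k)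
      = (u - b) * (p + s * b * q) + 1 / 2 * s * (u - b)\<^sup>2 * q"
    by (simp add: power2_eq_square field_simps)
  moreover have "1 / 2 * s * (u - b)\<^sup>2 * q \<le> 0"
    using assms by (intro mult_nonneg_nonpos) auto
  ultimately show ?thesis
    using assms by linarith
qed

lemma quadratic_roots_sign:
  fixes k b g :: real
  assumes "k > 0" and "g > 0"
  shows "(- b + sqrt (b\<^sup>2 + 2 * g * k)) / k > 0" and "(- b - sqrt (b\<^sup>2 + 2 * g * k)) / k < 0"
proof -
  have "sqrt (b\<^sup>2) < sqrt (b\<^sup>2 + 2 * g * k)"
    using assms by (intro real_sqrt_less_mono) simp
  then have "\<bar>b\<bar> < sqrt (b\<^sup>2 + 2 * g * k)"
    by (simp only: real_sqrt_abs)
  then show "(- b + sqrt (b\<^sup>2 + 2 * g * k)) / k > 0" and "(- b - sqrt (b\<^sup>2 + 2 * g * k)) / k < 0"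
    using assms by (auto simp: divide_simps)
qed

lemma quadratic_factor:
  fixes k b g t :: real
  assumes "k > 0" and "g > 0"
  shows "k / 2 * t\<^sup>2 + b * t - g =
    k / 2 * (t - (- b + sqrt (b\<^sup>2 + 2 * g * k)) / k) * (t - (- b - sqrt (b\<^sup>2 + 2 * g * k)) / k)"
proof -
  define S where "S = sqrt (b\<^sup>2 + 2 * g * k)"
  have "S\<^sup>2 = b\<^sup>2 + 2 * g * k"
    using assms by (simp add: S_def)
  moreover have "k / 2 * (t - (- b + S) / k) * (t - (- b - S) / k)
      = k / 2 * t\<^sup>2 + b * t - (S\<^sup>2 - b\<^sup>2) / (2 * k)"
    using assms by (simp add: field_simps power2_eq_square)
  ultimately show ?thesis
    using assms by (simp add: S_def)
qed

text \<open>
  A negative number lies to the left of the positive root, so the sign of the polynomial there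
  tells on which side of the negative root it lies.
\<close>

lemma negative_root_location:
  fixes k b g t :: real
  assumes "k > 0" and "g > 0" and "t < 0"
  defines "r \<equiv> (- b - sqrt (b\<^sup>2 + 2 * g * k)) / k"
  shows "k / 2 * t\<^sup>2 + b * t - g < 0 \<Longrightarrow> r < t" and "0 < k / 2 * t\<^sup>2 + b * t - g \<Longrightarrow> t < r"
proof -
  define w where "w = k / 2 * (t - (- b + sqrt (b\<^sup>2 + 2 * g * k)) / k)"
  have "w < 0"
    using assms(1,3) quadratic_roots_sign(1)[OF assms(1,2), of b]
    unfolding w_def by (intro mult_pos_neg) auto
  then have "w * (t - r) < 0 \<longleftrightarrow> r < t" and "0 < w * (t - r) \<longleftrightarrow> t < r"
    by (auto simp: mult_less_0_iff zero_less_mult_iff)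
  moreover have "k / 2 * t\<^sup>2 + b * t - g = w * (t - r)"
    using quadratic_factor[OF assms(1,2), of t b] by (simp add: w_def r_def)
  ultimately show "k / 2 * t\<^sup>2 + b * t - g < 0 \<Longrightarrow> r < t"
    and "0 < k / 2 * t\<^sup>2 + b * t - g \<Longrightarrow> t < r"
    by simp_all
qed

lemma exp_diff_mono:
  fixes P Q r s x y :: real
  assumes "P \<ge> 0" and "Q \<ge> 0" and "r \<ge> 0" and "s \<le> 0" and "x \<le> y"
  shows "P * exp (r * x) - Q * exp (s * x) \<le> P * exp (r * y) - Q * exp (s * y)"
proof -
  have "r * x \<le> r * y" and "s * y \<le> s * x"
    using assms by (auto intro: mult_left_mono mult_left_mono_neg)
  then have "P * exp (r * x) \<le> P * exp (r * y)" and "Q * exp (s * y) \<le> Q * exp (s * x)"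
    using assms by (auto intro: mult_left_mono)
  then show ?thesis
    by linarith
qed

lemma exp_balance:
  fixes P Q r s x :: real
  assumes "P > 0" and "Q > 0" and "s < r" and "x = 1 / (r - s) * ln (Q / P)"
  shows "P * exp (r * x) = Q * exp (s * x)"
proof -
  have "exp (r * x) = exp ((r - s) * x) * exp (s * x)"
    by (simp add: exp_add[symmetric] algebra_simps)
  also have "exp ((r - s) * x) = Q / P"
    using assms by simp
  finally show ?thesis
    using assms by simp
qed

text \<open>
  Differentiability is assumed of each function on its own side of the junction only, because the
  formula for the second branch of \<open>V\<close> need not have a meaningful continuation far beyond its
  interval.
\<close>

lemma DERIV_glue:
  fixes f g :: "real \<Rightarrow> real"
  assumes "x \<le> p \<Longrightarrow> DERIV f x :> f' x" and "p \<le> x \<Longrightarrow> DERIV g x :> g' x"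
    and "f p = g p" and "f' p = g' p"
  shows "DERIV (\<lambda>y. if y < p then f y else g y) x :> (if x < p then f' x else g' x)"
proof -
  have "((\<lambda>y. if y \<in> {..<p} then f y else g y) has_vector_derivative
      (if x \<in> {..<p} then f' x else g' x)) (at x within UNIV)"
    by (rule has_vector_derivative_If_within_closures[where T = "{p..}"])
      (use assms in \<open>auto simp: has_real_derivative_iff_has_vector_derivative
         intro: has_vector_derivative_at_within\<close>)
  then show ?thesis
    by (simp add: has_real_derivative_iff_has_vector_derivative)
qed

section \<open>Signs and orderings of the constants\<close>

locale hjb_problem = hjb_constants +
  assumes mu_pos: "\<mu> > 0" and sigma_pos: "\<sigma> > 0" and gamma_pos: "\<gamma> > 0"
    and delta_nonneg: "\<delta> \<ge> 0" and M_pos: "M > 0" and alpha_pos: "0 < \<alpha>"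
    and alpha_less_beta: "\<alpha> < \<beta>" and alpha_large: "2 * \<delta> / \<mu> < \<alpha>" and M_large: "M > M_beta"
begin

abbreviation D :: real where "D \<equiv> \<mu>\<^sup>2 + 2 * \<gamma> * \<sigma>\<^sup>2"

lemma beta_pos: "0 < \<beta>"
  using alpha_pos alpha_less_beta by simp

lemma D_pos: "D > 0"
  using mu_pos gamma_pos by (simp add: add_pos_nonneg)

lemma c_nonneg: "c \<ge> 0"
  unfolding c_def using D_pos mu_pos delta_nonneg by simp

lemma c_less_alpha: "c < \<alpha>"
proof -
  have "c * D = 2 * \<delta> * \<mu>"
    unfolding c_def using D_pos by simp
  also have "\<dots> = 2 * \<delta> / \<mu> * \<mu>\<^sup>2"
    using mu_pos by (simp add: power2_eq_square)
  also have "\<dots> < \<alpha> * \<mu>\<^sup>2"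
    using alpha_large mu_pos by (intro mult_strict_right_mono) auto
  also have "\<dots> \<le> \<alpha> * D"
    using alpha_pos gamma_pos by (simp add: algebra_simps)
  finally show ?thesis
    using D_pos mult_less_cancel_right_pos by blast
qed

lemma r_plus_pos: "z > 0 \<Longrightarrow> r_plus z > 0"
  and r_minus_neg: "z > 0 \<Longrightarrow> r_minus z < 0"
  and rt_minus_neg: "z > 0 \<Longrightarrow> rt_minus z < 0"
  using quadratic_roots_sign[of "\<sigma>\<^sup>2 * z\<^sup>2" \<gamma> "z * \<mu> - \<delta>"]
    quadratic_roots_sign(2)[of "\<sigma>\<^sup>2 * z\<^sup>2" \<gamma> "z * \<mu> - \<delta> - M"] sigma_pos gamma_pos
  by (simp_all add: r_plus_def r_minus_def rt_minus_def mult.assoc)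

lemma r_plus_root: "z > 0 \<Longrightarrow> 1 / 2 * \<sigma>\<^sup>2 * z\<^sup>2 * (r_plus z)\<^sup>2 + (z * \<mu> - \<delta>) * r_plus z - \<gamma> = 0"
  and r_minus_root:
    "z > 0 \<Longrightarrow> 1 / 2 * \<sigma>\<^sup>2 * z\<^sup>2 * (r_minus z)\<^sup>2 + (z * \<mu> - \<delta>) * r_minus z - \<gamma> = 0"
  and rt_minus_root:
    "z > 0 \<Longrightarrow> 1 / 2 * \<sigma>\<^sup>2 * z\<^sup>2 * (rt_minus z)\<^sup>2 + (z * \<mu> - \<delta> - M) * rt_minus z - \<gamma> = 0"
  using quadratic_factor[of "\<sigma>\<^sup>2 * z\<^sup>2" \<gamma> "r_plus z" "z * \<mu> - \<delta>"]
    quadratic_factor[of "\<sigma>\<^sup>2 * z\<^sup>2" \<gamma> "r_minus z" "z * \<mu> - \<delta>"]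
    quadratic_factor[of "\<sigma>\<^sup>2 * z\<^sup>2" \<gamma> "rt_minus z" "z * \<mu> - \<delta> - M"] sigma_pos gamma_pos
  by (simp_all add: r_plus_def r_minus_def rt_minus_def mult.assoc)

lemma r_minus_location:
  assumes "z > 0" and "t < 0" and "1 / 2 * \<sigma>\<^sup>2 * z\<^sup>2 * t\<^sup>2 + (z * \<mu> - \<delta>) * t - \<gamma> < 0"
  shows "r_minus z < t"
  using negative_root_location(1)[of "\<sigma>\<^sup>2 * z\<^sup>2" \<gamma> t "z * \<mu> - \<delta>"] assms sigma_pos gamma_pos
  by (simp add: r_minus_def mult.assoc)

lemma rt_minus_location:
  assumes "z > 0" and "t < 0" and "0 < 1 / 2 * \<sigma>\<^sup>2 * z\<^sup>2 * t\<^sup>2 + (z * \<mu> - \<delta> - M) * t - \<gamma>"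
  shows "t < rt_minus z"
  using negative_root_location(2)[of "\<sigma>\<^sup>2 * z\<^sup>2" \<gamma> t "z * \<mu> - \<delta> - M"] assms sigma_pos gamma_pos
  by (simp add: rt_minus_def mult.assoc)

lemma r_minus_drift_neg:
  assumes "z > c"
  shows "\<mu> + z * \<sigma>\<^sup>2 * r_minus z < 0"
proof -
  have z: "z > 0"
    using assms c_nonneg by simp
  let ?t = "- \<mu> / (z * \<sigma>\<^sup>2)"
  have "2 * \<delta> * \<mu> < z * D"
    using assms D_pos by (simp add: c_def field_simps)
  moreover have "1 / 2 * \<sigma>\<^sup>2 * z\<^sup>2 * ?t\<^sup>2 + (z * \<mu> - \<delta>) * ?t - \<gamma>
      = (2 * \<delta> * \<mu> - z * D) / (2 * z * \<sigma>\<^sup>2)"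
    using z sigma_pos by (simp add: field_simps power2_eq_square)
  ultimately have "1 / 2 * \<sigma>\<^sup>2 * z\<^sup>2 * ?t\<^sup>2 + (z * \<mu> - \<delta>) * ?t - \<gamma> < 0"
    using z sigma_pos by (simp add: divide_neg_pos)
  then have "r_minus z < ?t"
    using z sigma_pos mu_pos by (intro r_minus_location) auto
  then show ?thesis
    using z sigma_pos by (simp add: field_simps)
qed

lemma rt_minus_drift_pos: "\<mu> + \<beta> * \<sigma>\<^sup>2 * rt_minus \<beta> > 0"
proof -
  let ?t = "- \<mu> / (\<beta> * \<sigma>\<^sup>2)"
  have "M_beta * (2 * \<mu>) = (\<beta> - c) * D"
    using mu_pos by (simp add: M_beta_def)
  also have "\<dots> = \<beta> * D - 2 * \<delta> * \<mu>"
    using D_pos by (simp add: c_def left_diff_distrib)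
  finally have "\<beta> * D - 2 * \<delta> * \<mu> < M * (2 * \<mu>)"
    using M_large mu_pos by (metis mult_strict_right_mono zero_less_mult_iff zero_less_numeral)
  moreover have "1 / 2 * \<sigma>\<^sup>2 * \<beta>\<^sup>2 * ?t\<^sup>2 + (\<beta> * \<mu> - \<delta> - M) * ?t - \<gamma>
      = (M * (2 * \<mu>) - (\<beta> * D - 2 * \<delta> * \<mu>)) / (2 * \<beta> * \<sigma>\<^sup>2)"
    using beta_pos sigma_pos by (simp add: field_simps power2_eq_square)
  ultimately have "0 < 1 / 2 * \<sigma>\<^sup>2 * \<beta>\<^sup>2 * ?t\<^sup>2 + (\<beta> * \<mu> - \<delta> - M) * ?t - \<gamma>"
    using beta_pos sigma_pos by simp
  then have "?t < rt_minus \<beta>"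
    using beta_pos sigma_pos mu_pos by (intro rt_minus_location) auto
  then show ?thesis
    using beta_pos sigma_pos by (simp add: field_simps)
qed

text \<open>
  At \<open>rt_minus\<close>, the characteristic polynomial without the payout rate \<open>M\<close> has the negative value
  \<open>M rt_minus\<close>.
\<close>

lemma r_minus_less_rt_minus:
  assumes "z > 0"
  shows "r_minus z < rt_minus z"
proof (rule r_minus_location)
  have "M * rt_minus z < 0"
    using M_pos rt_minus_neg[OF assms] by (simp add: mult_pos_neg)
  then show "1 / 2 * \<sigma>\<^sup>2 * z\<^sup>2 * (rt_minus z)\<^sup>2 + (z * \<mu> - \<delta>) * rt_minus z - \<gamma> < 0"
    using rt_minus_root[OF assms] by (simp add: algebra_simps)
qed (use assms rt_minus_neg in auto)

section \<open>The free boundaries\<close>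

lemma x_alpha_pos: "x_alpha > 0"
proof -
  let ?p = "r_plus \<alpha>" and ?m = "r_minus \<alpha>"
  have signs: "?p > 0" "?m < 0" "\<mu> + \<alpha> * \<sigma>\<^sup>2 * ?m < 0"
    using alpha_pos c_less_alpha by (auto intro: r_plus_pos r_minus_neg r_minus_drift_neg)
  have P: "?p * (\<mu> + \<alpha> * \<sigma>\<^sup>2 * ?p) > 0"
    using signs alpha_pos sigma_pos mu_pos by (intro mult_pos_pos add_pos_pos) auto
  have "?p + ?m = - 2 * (\<alpha> * \<mu> - \<delta>) / (\<sigma>\<^sup>2 * \<alpha>\<^sup>2)"
    by (simp add: r_plus_def r_minus_def add_divide_distrib[symmetric] diff_divide_distrib[symmetric])
  then have "\<mu> + \<alpha> * \<sigma>\<^sup>2 * (?p + ?m) = (2 * \<delta> - \<alpha> * \<mu>) / \<alpha>"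
    using alpha_pos sigma_pos by (simp add: field_simps power2_eq_square)
  also have "\<dots> < 0"
    using alpha_large mu_pos alpha_pos by (simp add: field_simps)
  finally have "(?p - ?m) * (\<mu> + \<alpha> * \<sigma>\<^sup>2 * (?p + ?m)) < 0"
    using signs by (intro mult_pos_neg) auto
  then have "?p * (\<mu> + \<alpha> * \<sigma>\<^sup>2 * ?p) < ?m * (\<mu> + \<alpha> * \<sigma>\<^sup>2 * ?m)"
    by (simp add: algebra_simps)
  then have "ln ((?m * (\<mu> + \<alpha> * \<sigma>\<^sup>2 * ?m)) / (?p * (\<mu> + \<alpha> * \<sigma>\<^sup>2 * ?p))) > 0"
    using P by simp
  then show ?thesis
    unfolding x_alpha_def using signs by simp
qed

lemma DERIV_G: "u > c \<Longrightarrow> DERIV G u :> u / (u - c)"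
  unfolding G_def by (auto intro!: derivative_eq_intros simp: field_simps)

lemma G_strict_mono:
  assumes "c < u" and "u < v"
  shows "G u < G v"
proof (rule DERIV_pos_imp_increasing[OF assms(2)])
  fix x
  assume "u \<le> x" and "x \<le> v"
  then have "x > c" and "x / (x - c) > 0"
    using assms c_nonneg by auto
  then show "\<exists>y. DERIV G x :> y \<and> y > 0"
    using DERIV_G by blast
qed

lemma G_inv_G: "u > c \<Longrightarrow> G_inv (G u) = u"
proof -
  have "inj_on G {c<..}"
    using G_strict_mono by (intro strict_mono_on_imp_inj_on[of _ G] strict_mono_onI) auto
  then show "u > c \<Longrightarrow> G_inv (G u) = u"
    by (simp add: G_inv_def)
qed

lemma DERIV_G_inv:
  assumes "u > c"
  shows "DERIV G_inv (G u) :> (u - c) / u"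
proof -
  have "(G_inv has_derivative (*) ((u - c) / u)) (at (G u))"
  proof (rule has_derivative_inverse_strong[of "{c<..}" u G])
    show "continuous_on {c<..} G"
      by (intro continuous_at_imp_continuous_on ballI DERIV_isCont[OF DERIV_G]) simp
    show "(G has_derivative (*) (u / (u - c))) (at u)"
      using DERIV_G[OF assms] by (simp add: has_field_derivative_def)
    show "(*) (u / (u - c)) \<circ> (*) ((u - c) / u) = id"
      using assms c_nonneg by (auto simp: fun_eq_iff)
  qed (use assms G_inv_G in auto)
  then show ?thesis
    by (simp add: has_field_derivative_def)
qed

lemma x_alpha_less_x_beta: "x_alpha < x_beta"
proof -
  have "\<mu> * \<sigma>\<^sup>2 / D * (G \<beta> - G \<alpha>) > 0"
    using G_strict_mono[OF c_less_alpha alpha_less_beta] mu_pos sigma_pos D_pos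
    by (intro mult_pos_pos divide_pos_pos) auto
  then show ?thesis
    by (simp only: x_beta_def less_add_same_cancel1)
qed

lemma a_x_alpha: "a x_alpha = \<alpha>"
  by (simp add: a_def G_inv_G c_less_alpha)

lemma a_argument_x_beta: "D / (\<mu> * \<sigma>\<^sup>2) * (x_beta - x_alpha) + G \<alpha> = G \<beta>"
proof -
  have cancel: "k / l * (l / k * t) = t" if "k \<noteq> 0" "l \<noteq> 0" for k l t :: real
    using that by simp
  have "D \<noteq> 0" "\<mu> * \<sigma>\<^sup>2 \<noteq> 0"
    using D_pos mu_pos sigma_pos by auto
  note cancel[OF this, of "G \<beta> - G \<alpha>"]
  then show ?thesis
    by (simp only: x_beta_def add_diff_cancel_left' diff_add_cancel)
qed

lemma a_x_beta: "a x_beta = \<beta>"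
  using c_less_alpha alpha_less_beta by (simp only: a_def a_argument_x_beta G_inv_G less_trans)

text \<open>
  If \<open>c = 0\<close>, then \<open>G\<close> takes positive values only on its half-line, so \<open>G_inv\<close> is not meaningful
  on the whole real line. Between \<open>x_alpha\<close> and \<open>x_beta\<close> its argument runs from \<open>G \<alpha>\<close> to
  \<open>G \<beta>\<close>, and by continuity these are all values of \<open>G\<close>.
\<close>

lemma a_on_middle:
  assumes "x_alpha \<le> x" and "x \<le> x_beta"
  shows "\<alpha> \<le> a x" and "a x \<le> \<beta>" and "DERIV a x :> D * (a x - c) / (\<mu> * \<sigma>\<^sup>2 * a x)"
proof -
  define y where "y = (\<lambda>x. D / (\<mu> * \<sigma>\<^sup>2) * (x - x_alpha) + G \<alpha>)"
  have k: "D / (\<mu> * \<sigma>\<^sup>2) > 0"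
    using mu_pos sigma_pos D_pos by simp
  have "y x_beta = G \<beta>"
    unfolding y_def by (rule a_argument_x_beta)
  moreover have "y x \<le> y x_beta"
    unfolding y_def using k assms by (intro add_right_mono mult_left_mono) auto
  moreover have "D / (\<mu> * \<sigma>\<^sup>2) * (x - x_alpha) \<ge> 0"
    using k assms by (intro mult_nonneg_nonneg) auto
  ultimately have "G \<alpha> \<le> y x" and "y x \<le> G \<beta>"
    unfolding y_def by linarith+
  moreover have "continuous_on {\<alpha>..\<beta>} G"
    using c_less_alpha
    by (intro continuous_at_imp_continuous_on ballI DERIV_isCont[OF DERIV_G]) simp
  ultimately obtain u where u: "\<alpha> \<le> u" "u \<le> \<beta>" "G u = y x"
    using IVT'[of G \<alpha> "y x" \<beta>] alpha_less_beta by auto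
  then have "u > c"
    using c_less_alpha by simp
  have a_eq: "a = (\<lambda>x. G_inv (y x))"
    by (simp add: fun_eq_iff a_def y_def)
  then have "a x = u"
    using u G_inv_G[OF \<open>u > c\<close>] by simp
  then show "\<alpha> \<le> a x" and "a x \<le> \<beta>"
    using u by auto
  have "DERIV G_inv (y x) :> (u - c) / u"
    using DERIV_G_inv[OF \<open>u > c\<close>] u by simp
  moreover have "DERIV y x :> D / (\<mu> * \<sigma>\<^sup>2)"
    unfolding y_def using mu_pos sigma_pos by (auto intro!: derivative_eq_intros)
  ultimately have "DERIV (\<lambda>x. G_inv (y x)) x :> (u - c) / u * (D / (\<mu> * \<sigma>\<^sup>2))"
    by (rule DERIV_chain2)
  then show "DERIV a x :> D * (a x - c) / (\<mu> * \<sigma>\<^sup>2 * a x)"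
    using \<open>a x = u\<close> by (simp add: a_eq mult.commute)
qed

text \<open>
  These are the denominator and the numerator in the logarithm that defines \<open>Delta\<close>. Their
  difference is \<open>(r_plus \<beta> - r_minus \<beta>) (\<mu> + \<beta> \<sigma>\<^sup>2 rt_minus \<beta>)\<close>, which is positive because
  \<open>M > M_beta\<close>.
\<close>

lemma Delta_weights:
  shows "(rt_minus \<beta> - r_minus \<beta>) * (\<mu> + \<beta> * \<sigma>\<^sup>2 * r_plus \<beta>) > 0"
    and "(r_plus \<beta> - rt_minus \<beta>) * (- (\<mu> + \<beta> * \<sigma>\<^sup>2 * r_minus \<beta>)) > 0"
    and "(r_plus \<beta> - rt_minus \<beta>) * (- (\<mu> + \<beta> * \<sigma>\<^sup>2 * r_minus \<beta>))
      < (rt_minus \<beta> - r_minus \<beta>) * (\<mu> + \<beta> * \<sigma>\<^sup>2 * r_plus \<beta>)"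
proof -
  have signs: "r_plus \<beta> > 0" "rt_minus \<beta> < 0" "r_minus \<beta> < rt_minus \<beta>"
    "\<mu> + \<beta> * \<sigma>\<^sup>2 * r_minus \<beta> < 0"
    using beta_pos c_less_alpha alpha_less_beta
    by (auto intro: r_plus_pos rt_minus_neg r_minus_less_rt_minus r_minus_drift_neg)
  have "\<mu> + \<beta> * \<sigma>\<^sup>2 * r_plus \<beta> > 0"
    using signs beta_pos sigma_pos mu_pos by (intro add_pos_pos) auto
  then show "(rt_minus \<beta> - r_minus \<beta>) * (\<mu> + \<beta> * \<sigma>\<^sup>2 * r_plus \<beta>) > 0"
    using signs by simp
  show "(r_plus \<beta> - rt_minus \<beta>) * (- (\<mu> + \<beta> * \<sigma>\<^sup>2 * r_minus \<beta>)) > 0"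
    using signs by (intro mult_pos_pos) auto
  have "(r_plus \<beta> - r_minus \<beta>) * (\<mu> + \<beta> * \<sigma>\<^sup>2 * rt_minus \<beta>) > 0"
    using signs rt_minus_drift_pos by (intro mult_pos_pos) auto
  then show "(r_plus \<beta> - rt_minus \<beta>) * (- (\<mu> + \<beta> * \<sigma>\<^sup>2 * r_minus \<beta>))
      < (rt_minus \<beta> - r_minus \<beta>) * (\<mu> + \<beta> * \<sigma>\<^sup>2 * r_plus \<beta>)"
    by (simp add: algebra_simps)
qed

text \<open>Moving the sign inside makes the logarithm one of a quotient of positive numbers.\<close>

lemma Delta_eq:
  "Delta = 1 / (r_plus \<beta> - r_minus \<beta>) *
     ln ((r_plus \<beta> - rt_minus \<beta>) * (- (\<mu> + \<beta> * \<sigma>\<^sup>2 * r_minus \<beta>)) /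
         ((rt_minus \<beta> - r_minus \<beta>) * (\<mu> + \<beta> * \<sigma>\<^sup>2 * r_plus \<beta>)))"
  unfolding Delta_def by (simp only: mult_minus_right minus_divide_left)

lemma x_beta_less_x_1: "x_beta < x_1"
proof -
  have "r_plus \<beta> - r_minus \<beta> > 0"
    using r_plus_pos[OF beta_pos] r_minus_neg[OF beta_pos] by simp
  then have "Delta < 0"
    unfolding Delta_eq using Delta_weights by (intro mult_pos_neg ln_less_zero) auto
  then show ?thesis
    by (simp add: x_1_def)
qed

section \<open>The four branches and their derivatives\<close>

text \<open>
  The index \<open>n\<close> is the order of the derivative. This lets one gluing argument serve both \<open>V\<close>
  and \<open>V'\<close>. The function \<open>mid\<close> is meant for \<open>n \<le> 2\<close> only.
\<close>

definition low :: "nat \<Rightarrow> real \<Rightarrow> real" where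
  "low n x = K1_alpha_beta *
     (r_plus \<alpha> ^ n * exp (r_plus \<alpha> * x) - r_minus \<alpha> ^ n * exp (r_minus \<alpha> * x))"

definition mid :: "nat \<Rightarrow> real \<Rightarrow> real" where
  "mid n x = dV_alpha * (if n = 0 then (\<mu> * a x - 2 * \<delta>) / (2 * \<gamma>)
     else if n = 1 then 1 else - \<mu> / (\<sigma>\<^sup>2 * a x)) * ((a x - c) / (\<alpha> - c)) powr (- Gam)"

definition high :: "nat \<Rightarrow> real \<Rightarrow> real" where
  "high n x = K1_beta * r_plus \<beta> ^ n * exp (r_plus \<beta> * (x - x_1))
     + K2_beta * r_minus \<beta> ^ n * exp (r_minus \<beta> * (x - x_1))"

definition payout :: "nat \<Rightarrow> real \<Rightarrow> real" where
  "payout n x = (if n = 0 then M / \<gamma> else 0)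
     + rt_minus \<beta> ^ n / rt_minus \<beta> * exp (rt_minus \<beta> * (x - x_1))"

definition W :: "nat \<Rightarrow> real \<Rightarrow> real" where
  "W n x = (if x < x_alpha then low n x else if x < x_beta then mid n x
     else if x < x_1 then high n x else payout n x)"

lemma W_0: "W 0 = V"
  by (simp add: fun_eq_iff W_def V_def low_def mid_def high_def payout_def)

lemma DERIV_low: "DERIV (low n) x :> low (Suc n) x"
  unfolding low_def by (auto intro!: derivative_eq_intros simp: algebra_simps)

lemma DERIV_high: "DERIV (high n) x :> high (Suc n) x"
  unfolding high_def by (auto intro!: derivative_eq_intros simp: algebra_simps)

lemma DERIV_payout: "DERIV (payout n) x :> payout (Suc n) x"
  unfolding payout_def by (auto intro!: derivative_eq_intros simp: algebra_simps)

lemma DERIV_mid: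
  assumes "x_alpha \<le> x" and "x \<le> x_beta" and "n < 2"
  shows "DERIV (mid n) x :> mid (Suc n) x"
proof -
  note a = a_on_middle[OF assms(1,2)]
  have ac: "a x - c > 0" and a0: "a x > 0"
    using a(1) c_less_alpha alpha_pos by auto
  define w where "w = (\<lambda>x. ((a x - c) / (\<alpha> - c)) powr (- Gam))"
  have w_pos: "(a x - c) / (\<alpha> - c) > 0"
    using ac c_less_alpha by simp
  have Gam_D: "Gam * D = \<mu>\<^sup>2" and c_D: "c * D = 2 * \<delta> * \<mu>"
    using D_pos by (simp_all add: Gam_def c_def)
  have "DERIV (\<lambda>x. a x - c) x :> D * (a x - c) / (\<mu> * \<sigma>\<^sup>2 * a x)"
    using DERIV_diff[OF a(3) DERIV_const[of c]] by simp
  then have du: "DERIV (\<lambda>x. (a x - c) / (\<alpha> - c)) x :>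
      D * (a x - c) / (\<mu> * \<sigma>\<^sup>2 * a x) / (\<alpha> - c)"
    by (rule DERIV_cdivide)
  have "DERIV w x :> w x * ((D * (a x - c) / (\<mu> * \<sigma>\<^sup>2 * a x) / (\<alpha> - c)) * (- Gam)
      / ((a x - c) / (\<alpha> - c)))"
    using DERIV_powr[OF du w_pos DERIV_const[of "- Gam"]] by (simp add: w_def)
  also have "(D * (a x - c) / (\<mu> * \<sigma>\<^sup>2 * a x) / (\<alpha> - c)) * (- Gam) / ((a x - c) / (\<alpha> - c))
      = - (Gam * D) / (\<mu> * \<sigma>\<^sup>2 * a x)"
  proof -
    have "l * v / q / e * (- g) / (v / e) = - (g * l) / q"
      if "v \<noteq> 0" "e \<noteq> 0" for l v q e g :: real
      using that by simp
    then show ?thesis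
      by this (use ac c_less_alpha in auto)
  qed
  also have "\<dots> = - \<mu> / (\<sigma>\<^sup>2 * a x)"
    unfolding Gam_D using mu_pos by (simp add: power2_eq_square)
  finally have dw: "DERIV w x :> w x * (- \<mu> / (\<sigma>\<^sup>2 * a x))" .
  show ?thesis
  proof (cases "n = 0")
    case True
    \<comment> \<open>The constants \<open>c\<close> and \<open>Gam\<close> are such that the derivative of \<open>(\<mu> a - 2 \<delta>) / (2 \<gamma>)\<close> and that
      of the power add up to the power itself.\<close>
    have "D * (a x - c) - \<mu> * (\<mu> * a x - 2 * \<delta>) = 2 * \<gamma> * \<sigma>\<^sup>2 * a x"
      using c_D by (simp add: algebra_simps power2_eq_square)
    moreover have "\<mu> * (N / (\<mu> * \<sigma>\<^sup>2 * a x)) / (2 * \<gamma>) + T / (2 * \<gamma>) * (- \<mu> / (\<sigma>\<^sup>2 * a x))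
        = (N - \<mu> * T) / (2 * \<gamma> * \<sigma>\<^sup>2 * a x)" for N T
      using mu_pos sigma_pos gamma_pos a0 by (simp add: field_simps)
    ultimately have "\<mu> * (D * (a x - c) / (\<mu> * \<sigma>\<^sup>2 * a x)) / (2 * \<gamma>)
        + (\<mu> * a x - 2 * \<delta>) / (2 * \<gamma>) * (- \<mu> / (\<sigma>\<^sup>2 * a x)) = 1"
      using sigma_pos gamma_pos a0 by simp
    then have eq: "\<mu> * (D * (a x - c) / (\<mu> * \<sigma>\<^sup>2 * a x)) / (2 * \<gamma>) * w x
        + w x * (- \<mu> / (\<sigma>\<^sup>2 * a x)) * ((\<mu> * a x - 2 * \<delta>) / (2 * \<gamma>)) = w x"
      by algebra
    have "DERIV (\<lambda>x. \<mu> * a x - 2 * \<delta>) x :> \<mu> * (D * (a x - c) / (\<mu> * \<sigma>\<^sup>2 * a x))"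
      using DERIV_diff[OF DERIV_cmult[OF a(3), of \<mu>] DERIV_const[of "2 * \<delta>"]]
      unfolding diff_0_right .
    then have "DERIV (\<lambda>x. (\<mu> * a x - 2 * \<delta>) / (2 * \<gamma>)) x :>
        \<mu> * (D * (a x - c) / (\<mu> * \<sigma>\<^sup>2 * a x)) / (2 * \<gamma>)"
      by (rule DERIV_cdivide)
    from DERIV_cmult[OF DERIV_mult[OF this dw], of dV_alpha]
    have "DERIV (\<lambda>x. dV_alpha * ((\<mu> * a x - 2 * \<delta>) / (2 * \<gamma>) * w x)) x :> dV_alpha * w x"
      unfolding eq .
    moreover have "mid 0 = (\<lambda>x. dV_alpha * ((\<mu> * a x - 2 * \<delta>) / (2 * \<gamma>) * w x))"
      and "mid 1 x = dV_alpha * w x"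
      by (simp_all add: fun_eq_iff mid_def w_def)
    ultimately show ?thesis
      using True by simp
  next
    case False
    then have "n = 1"
      using assms by simp
    moreover have "DERIV (\<lambda>x. dV_alpha * w x) x :> dV_alpha * (w x * (- \<mu> / (\<sigma>\<^sup>2 * a x)))"
      using dw by (rule DERIV_cmult)
    moreover have "mid 1 = (\<lambda>x. dV_alpha * w x)"
      and "mid 2 x = dV_alpha * (w x * (- \<mu> / (\<sigma>\<^sup>2 * a x)))"
      by (simp_all add: fun_eq_iff mid_def w_def)
    ultimately show ?thesis
      by (simp add: numeral_2_eq_2)
  qed
qed

lemma low_ode: "1 / 2 * \<sigma>\<^sup>2 * \<alpha>\<^sup>2 * low 2 x + (\<alpha> * \<mu> - \<delta>) * low 1 x - \<gamma> * low 0 x = 0"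
proof -
  let ?q = "\<lambda>r. 1 / 2 * \<sigma>\<^sup>2 * \<alpha>\<^sup>2 * r\<^sup>2 + (\<alpha> * \<mu> - \<delta>) * r - \<gamma>"
  have "1 / 2 * \<sigma>\<^sup>2 * \<alpha>\<^sup>2 * low 2 x + (\<alpha> * \<mu> - \<delta>) * low 1 x - \<gamma> * low 0 x =
      K1_alpha_beta * (?q (r_plus \<alpha>) * exp (r_plus \<alpha> * x) - ?q (r_minus \<alpha>) * exp (r_minus \<alpha> * x))"
    unfolding low_def by (simp add: algebra_simps)
  then show ?thesis
    unfolding r_plus_root[OF alpha_pos] r_minus_root[OF alpha_pos] by simp
qed

lemma high_ode: "1 / 2 * \<sigma>\<^sup>2 * \<beta>\<^sup>2 * high 2 x + (\<beta> * \<mu> - \<delta>) * high 1 x - \<gamma> * high 0 x = 0"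
proof -
  let ?q = "\<lambda>r. 1 / 2 * \<sigma>\<^sup>2 * \<beta>\<^sup>2 * r\<^sup>2 + (\<beta> * \<mu> - \<delta>) * r - \<gamma>"
  have "1 / 2 * \<sigma>\<^sup>2 * \<beta>\<^sup>2 * high 2 x + (\<beta> * \<mu> - \<delta>) * high 1 x - \<gamma> * high 0 x =
      K1_beta * ?q (r_plus \<beta>) * exp (r_plus \<beta> * (x - x_1))
      + K2_beta * ?q (r_minus \<beta>) * exp (r_minus \<beta> * (x - x_1))"
    unfolding high_def by (simp add: algebra_simps)
  then show ?thesis
    unfolding r_plus_root[OF beta_pos] r_minus_root[OF beta_pos] by simp
qed

lemma mid_second: "a x > 0 \<Longrightarrow> \<mu> * mid 1 x + \<sigma>\<^sup>2 * a x * mid 2 x = 0"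
  using sigma_pos by (simp add: mid_def)

lemma mid_ode:
  assumes "a x > 0"
  shows "1 / 2 * \<sigma>\<^sup>2 * (a x)\<^sup>2 * mid 2 x + (a x * \<mu> - \<delta>) * mid 1 x - \<gamma> * mid 0 x = 0"
proof -
  have "1 / 2 * \<sigma>\<^sup>2 * (a x)\<^sup>2 * mid 2 x = - (a x / 2) * \<mu> * mid 1 x"
    using mid_second[OF assms] by algebra
  moreover have "\<gamma> * mid 0 x = (\<mu> * a x - 2 * \<delta>) / 2 * mid 1 x"
    using gamma_pos by (simp add: mid_def)
  ultimately show ?thesis
    by (simp add: algebra_simps)
qed

lemma payout_ode:
  "1 / 2 * \<sigma>\<^sup>2 * \<beta>\<^sup>2 * payout 2 x + (\<beta> * \<mu> - \<delta>) * payout 1 x - \<gamma> * payout 0 x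
    + M * (1 - payout 1 x) = 0"
proof -
  let ?r = "rt_minus \<beta>" and ?e = "exp (rt_minus \<beta> * (x - x_1))"
  have r: "?r \<noteq> 0"
    using rt_minus_neg[OF beta_pos] by simp
  have *: "payout 0 x = M / \<gamma> + ?e / ?r" "payout 1 x = ?e" "payout 2 x = ?r * ?e"
    using r by (simp_all add: payout_def power2_eq_square)
  have "1 / 2 * \<sigma>\<^sup>2 * \<beta>\<^sup>2 * payout 2 x + (\<beta> * \<mu> - \<delta>) * payout 1 x - \<gamma> * payout 0 x
      + M * (1 - payout 1 x)
      = (1 / 2 * \<sigma>\<^sup>2 * \<beta>\<^sup>2 * ?r\<^sup>2 + (\<beta> * \<mu> - \<delta> - M) * ?r - \<gamma>) * ?e / ?r"
    unfolding * using r gamma_pos by (simp add: field_simps power2_eq_square)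
  then show ?thesis
    unfolding rt_minus_root[OF beta_pos] by simp
qed

section \<open>Smooth fit\<close>

text \<open>
  The sum \<open>\<mu> V' + b \<sigma>\<^sup>2 V''\<close> decides whether the optimal control lies above or below \<open>b\<close>. On
  the first and third branches it is a combination of the same two exponentials as \<open>V\<close>.
\<close>

lemma low_drift:
  "\<mu> * low 1 x + \<sigma>\<^sup>2 * \<alpha> * low 2 x = K1_alpha_beta *
    (r_plus \<alpha> * (\<mu> + \<alpha> * \<sigma>\<^sup>2 * r_plus \<alpha>) * exp (r_plus \<alpha> * x)
     - r_minus \<alpha> * (\<mu> + \<alpha> * \<sigma>\<^sup>2 * r_minus \<alpha>) * exp (r_minus \<alpha> * x))"
  unfolding low_def by (simp add: algebra_simps power2_eq_square)

lemma high_eq: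
  assumes "n > 0"
  shows "high n x =
    ((rt_minus \<beta> - r_minus \<beta>) * r_plus \<beta> ^ (n - 1) * exp (r_plus \<beta> * (x - x_1))
     + (r_plus \<beta> - rt_minus \<beta>) * r_minus \<beta> ^ (n - 1) * exp (r_minus \<beta> * (x - x_1)))
    / (r_plus \<beta> - r_minus \<beta>)"
proof -
  obtain m where n: "n = Suc m"
    using assms gr0_implies_Suc by blast
  have "r_plus \<beta> > 0" "r_minus \<beta> < 0"
    using r_plus_pos[OF beta_pos] r_minus_neg[OF beta_pos] by auto
  then show ?thesis
    unfolding high_def K1_beta_def K2_beta_def n by (simp add: add_divide_distrib)
qed

lemma high_drift:
  "\<mu> * high 1 x + \<sigma>\<^sup>2 * \<beta> * high 2 x =
    ((rt_minus \<beta> - r_minus \<beta>) * (\<mu> + \<beta> * \<sigma>\<^sup>2 * r_plus \<beta>) * exp (r_plus \<beta> * (x - x_1))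
     - (r_plus \<beta> - rt_minus \<beta>) * (- (\<mu> + \<beta> * \<sigma>\<^sup>2 * r_minus \<beta>)) * exp (r_minus \<beta> * (x - x_1)))
    / (r_plus \<beta> - r_minus \<beta>)"
proof -
  have combine: "\<mu> * (X / d) + \<sigma>\<^sup>2 * \<beta> * (Y / d) = (\<mu> * X + \<sigma>\<^sup>2 * \<beta> * Y) / d" for X Y d
    by (simp add: add_divide_distrib)
  show ?thesis
    unfolding high_eq[OF zero_less_one] high_eq[OF pos2] combine
    by (rule arg_cong[of _ _ "\<lambda>t. t / _"]) (simp add: algebra_simps)
qed

lemma low_drift_x_alpha: "\<mu> * low 1 x_alpha + \<sigma>\<^sup>2 * \<alpha> * low 2 x_alpha = 0"
proof -
  have signs: "r_plus \<alpha> > 0" "r_minus \<alpha> < 0" "\<mu> + \<alpha> * \<sigma>\<^sup>2 * r_minus \<alpha> < 0"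
    using alpha_pos c_less_alpha by (auto intro: r_plus_pos r_minus_neg r_minus_drift_neg)
  have "r_plus \<alpha> * (\<mu> + \<alpha> * \<sigma>\<^sup>2 * r_plus \<alpha>) * exp (r_plus \<alpha> * x_alpha)
      = r_minus \<alpha> * (\<mu> + \<alpha> * \<sigma>\<^sup>2 * r_minus \<alpha>) * exp (r_minus \<alpha> * x_alpha)"
  proof (rule exp_balance)
    show "r_plus \<alpha> * (\<mu> + \<alpha> * \<sigma>\<^sup>2 * r_plus \<alpha>) > 0"
      using signs alpha_pos sigma_pos mu_pos by (intro mult_pos_pos add_pos_pos) auto
    show "r_minus \<alpha> * (\<mu> + \<alpha> * \<sigma>\<^sup>2 * r_minus \<alpha>) > 0"
      using signs by (intro mult_neg_neg) auto
  qed (use signs in \<open>auto simp: x_alpha_def\<close>)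
  then show ?thesis
    unfolding low_drift by simp
qed

lemma high_balance:
  "(rt_minus \<beta> - r_minus \<beta>) * (\<mu> + \<beta> * \<sigma>\<^sup>2 * r_plus \<beta>) * exp (r_plus \<beta> * Delta)
   = (r_plus \<beta> - rt_minus \<beta>) * (- (\<mu> + \<beta> * \<sigma>\<^sup>2 * r_minus \<beta>)) * exp (r_minus \<beta> * Delta)"
  using Delta_weights r_plus_pos[OF beta_pos] r_minus_neg[OF beta_pos]
  by (intro exp_balance Delta_eq) auto

lemma high_drift_x_beta: "\<mu> * high 1 x_beta + \<sigma>\<^sup>2 * \<beta> * high 2 x_beta = 0"
proof -
  have "x_beta - x_1 = Delta"
    by (simp add: x_1_def)
  then show ?thesis
    unfolding high_drift by (simp only: high_balance diff_self div_0)
qed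

lemma low_1_x_alpha: "low 1 x_alpha = dV_alpha"
proof -
  have "r_plus \<alpha> * exp (r_plus \<alpha> * x_alpha) > 0" "r_minus \<alpha> * exp (r_minus \<alpha> * x_alpha) < 0"
    using r_plus_pos[OF alpha_pos] r_minus_neg[OF alpha_pos] by (auto simp: mult_neg_pos)
  then show ?thesis
    by (simp add: low_def K1_alpha_beta_def)
qed

lemma high_1_x_beta: "high 1 x_beta = dV_beta"
proof -
  let ?p = "r_plus \<beta>" and ?m = "r_minus \<beta>" and ?t = "rt_minus \<beta>"
  have pos: "?p - ?m > 0" "\<mu> + \<beta> * \<sigma>\<^sup>2 * ?p > 0"
    using r_plus_pos[OF beta_pos] r_minus_neg[OF beta_pos] mu_pos sigma_pos beta_pos
    by (auto intro: add_pos_pos)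
  have "((?t - ?m) * exp (?p * Delta) + (?p - ?t) * exp (?m * Delta)) * (\<mu> + \<beta> * \<sigma>\<^sup>2 * ?p)
      = \<beta> * \<sigma>\<^sup>2 * exp (?m * Delta) * (?p - ?t) * (?p - ?m)"
    using high_balance by (simp add: algebra_simps)
  then have "((?t - ?m) * exp (?p * Delta) + (?p - ?t) * exp (?m * Delta)) / (?p - ?m)
      = \<beta> * \<sigma>\<^sup>2 * exp (?m * Delta) * (?p - ?t) / (\<mu> + \<beta> * \<sigma>\<^sup>2 * ?p)"
    using pos by (simp add: frac_eq_eq)
  then show ?thesis
    by (simp add: high_eq dV_beta_def x_1_def)
qed

text \<open>
  At \<open>x_alpha\<close> and \<open>x_beta\<close> the first derivatives agree by the choice of a factor, and the second
  derivatives by the choice of the point. The values then agree because both branches satisfy the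
  differential equation with the same control there.
\<close>

lemma match_x_alpha:
  assumes "n \<le> 2"
  shows "low n x_alpha = mid n x_alpha"
proof -
  have one: "low 1 x_alpha = mid 1 x_alpha"
    using c_less_alpha by (simp add: low_1_x_alpha[unfolded One_nat_def] mid_def a_x_alpha)
  have "\<sigma>\<^sup>2 * \<alpha> * low 2 x_alpha = \<sigma>\<^sup>2 * \<alpha> * mid 2 x_alpha"
    using low_drift_x_alpha mid_second[of x_alpha] alpha_pos unfolding a_x_alpha one by linarith
  then have two: "low 2 x_alpha = mid 2 x_alpha"
    using sigma_pos alpha_pos by simp
  have "\<gamma> * low 0 x_alpha = \<gamma> * mid 0 x_alpha"
    using low_ode[of x_alpha] mid_ode[of x_alpha] alpha_pos
    unfolding a_x_alpha one two by linarith
  then have "low 0 x_alpha = mid 0 x_alpha"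
    using gamma_pos by simp
  then show ?thesis
    using assms one two by (auto simp: le_Suc_eq numeral_2_eq_2)
qed

lemma match_x_beta:
  assumes "n \<le> 2"
  shows "mid n x_beta = high n x_beta"
proof -
  have "dV_alpha * ((\<beta> - c) / (\<alpha> - c)) powr (- Gam) = dV_beta"
    using c_less_alpha alpha_less_beta by (simp add: dV_alpha_def powr_minus)
  then have one: "mid 1 x_beta = high 1 x_beta"
    by (simp add: high_1_x_beta[unfolded One_nat_def] mid_def a_x_beta)
  have "\<sigma>\<^sup>2 * \<beta> * mid 2 x_beta = \<sigma>\<^sup>2 * \<beta> * high 2 x_beta"
    using high_drift_x_beta mid_second[of x_beta] beta_pos unfolding a_x_beta one by linarith
  then have two: "mid 2 x_beta = high 2 x_beta"
    using sigma_pos beta_pos by simp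
  have "\<gamma> * mid 0 x_beta = \<gamma> * high 0 x_beta"
    using high_ode[of x_beta] mid_ode[of x_beta] beta_pos
    unfolding a_x_beta one two by linarith
  then have "mid 0 x_beta = high 0 x_beta"
    using gamma_pos by simp
  then show ?thesis
    using assms one two by (auto simp: le_Suc_eq numeral_2_eq_2)
qed

lemma payout_x_1: "payout 1 x_1 = 1" "payout 2 x_1 = rt_minus \<beta>"
  using rt_minus_neg[OF beta_pos] by (simp_all add: payout_def power2_eq_square)

lemma match_x_1:
  assumes "n \<le> 2"
  shows "high n x_1 = payout n x_1"
proof -
  have pos: "r_plus \<beta> - r_minus \<beta> > 0"
    using r_plus_pos[OF beta_pos] r_minus_neg[OF beta_pos] by simp
  then have one: "high 1 x_1 = 1" and two: "high 2 x_1 = rt_minus \<beta>"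
    by (simp_all add: high_eq[of 1, simplified] high_eq[of 2] field_simps)
  have "\<gamma> * high 0 x_1 = \<gamma> * payout 0 x_1"
    using high_ode[of x_1] payout_ode[of x_1] unfolding one two payout_x_1 by simp
  then have "high 0 x_1 = payout 0 x_1"
    using gamma_pos by simp
  then show ?thesis
    using assms one two payout_x_1 by (auto simp: le_Suc_eq numeral_2_eq_2)
qed

text \<open>
  The branches are joined from right to left. The junction at \<open>x_beta\<close> is treated for arguments
  from \<open>x_alpha\<close> on, where \<open>mid\<close> is differentiable up to \<open>x_beta\<close>.
\<close>

lemma DERIV_W:
  assumes "n < 2"
  shows "DERIV (W n) x :> W (Suc n) x"
proof -
  note order = x_alpha_less_x_beta x_beta_less_x_1
  define R where "R = (\<lambda>n x. if x < x_1 then high n x else payout n x)"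
  define S where "S = (\<lambda>n x. if x < x_beta then mid n x else R n x)"
  have R: "DERIV (R n) x :> R (Suc n) x" for x
    unfolding R_def
    using assms by (intro DERIV_glue DERIV_high DERIV_payout match_x_1) auto
  have S: "DERIV (S n) x :> S (Suc n) x" if "x_alpha \<le> x" for x
    unfolding S_def
    using assms order that match_x_beta[of n] match_x_beta[of "Suc n"]
    by (intro DERIV_glue DERIV_mid R) (auto simp: R_def)
  have W: "W k = (\<lambda>x. if x < x_alpha then low k x else S k x)" for k
    by (simp add: fun_eq_iff W_def S_def R_def)
  show ?thesis
    unfolding W
    using assms order match_x_alpha[of n] match_x_alpha[of "Suc n"]
    by (intro DERIV_glue DERIV_low S) (auto simp: S_def)
qed

section \<open>Concavity and the optimal control\<close>

lemma dV_beta_pos: "dV_beta > 0"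
proof -
  have "r_plus \<beta> > 0" "rt_minus \<beta> < 0"
    using r_plus_pos[OF beta_pos] rt_minus_neg[OF beta_pos] by auto
  moreover from this have "\<mu> + \<beta> * \<sigma>\<^sup>2 * r_plus \<beta> > 0"
    using mu_pos sigma_pos beta_pos by (intro add_pos_pos) auto
  ultimately show ?thesis
    unfolding dV_beta_def using sigma_pos beta_pos by simp
qed

lemma dV_alpha_pos: "dV_alpha > 0"
  unfolding dV_alpha_def using dV_beta_pos c_less_alpha alpha_less_beta by simp

lemma K1_alpha_beta_pos: "K1_alpha_beta > 0"
proof -
  have "r_plus \<alpha> * exp (r_plus \<alpha> * x_alpha) > 0" "r_minus \<alpha> * exp (r_minus \<alpha> * x_alpha) < 0"
    using r_plus_pos[OF alpha_pos] r_minus_neg[OF alpha_pos] by (auto simp: mult_neg_pos)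
  then show ?thesis
    by (simp add: K1_alpha_beta_def dV_alpha_pos)
qed

lemma low_1_pos: "low 1 x > 0"
proof -
  have "r_plus \<alpha> * exp (r_plus \<alpha> * x) > 0" "r_minus \<alpha> * exp (r_minus \<alpha> * x) < 0"
    using r_plus_pos[OF alpha_pos] r_minus_neg[OF alpha_pos] by (auto simp: mult_neg_pos)
  then show ?thesis
    by (simp add: low_def K1_alpha_beta_pos)
qed

text \<open>
  Both drift combinations are nondecreasing, so that of \<open>low\<close> is nonpositive up to its zero
  \<open>x_alpha\<close> and that of \<open>high\<close> nonnegative from its zero \<open>x_beta\<close> on. This makes \<open>\<alpha>\<close> and \<open>\<beta>\<close>
  the constrained maximisers.
\<close>

lemma low_drift_nonpos:
  assumes "x \<le> x_alpha"
  shows "\<mu> * low 1 x + \<sigma>\<^sup>2 * \<alpha> * low 2 x \<le> 0"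
proof -
  have signs: "r_plus \<alpha> > 0" "r_minus \<alpha> < 0" "\<mu> + \<alpha> * \<sigma>\<^sup>2 * r_minus \<alpha> < 0"
    using alpha_pos c_less_alpha by (auto intro: r_plus_pos r_minus_neg r_minus_drift_neg)
  have "r_plus \<alpha> * (\<mu> + \<alpha> * \<sigma>\<^sup>2 * r_plus \<alpha>) \<ge> 0"
    using signs alpha_pos mu_pos by (intro mult_nonneg_nonneg add_nonneg_nonneg) auto
  moreover have "r_minus \<alpha> * (\<mu> + \<alpha> * \<sigma>\<^sup>2 * r_minus \<alpha>) \<ge> 0"
    using signs by (intro mult_nonpos_nonpos) auto
  ultimately have "\<mu> * low 1 x + \<sigma>\<^sup>2 * \<alpha> * low 2 x
      \<le> \<mu> * low 1 x_alpha + \<sigma>\<^sup>2 * \<alpha> * low 2 x_alpha"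
    unfolding low_drift using K1_alpha_beta_pos signs assms
    by (intro mult_left_mono exp_diff_mono) auto
  then show ?thesis
    unfolding low_drift_x_alpha .
qed

lemma low_2_neg:
  assumes "x \<le> x_alpha"
  shows "low 2 x < 0"
proof -
  have "\<mu> * low 1 x > 0"
    using mu_pos low_1_pos by simp
  then have "\<sigma>\<^sup>2 * \<alpha> * low 2 x < 0"
    using low_drift_nonpos[OF assms] by linarith
  then show ?thesis
    using sigma_pos alpha_pos by (simp add: mult_less_0_iff)
qed

lemma mid_signs:
  assumes "x_alpha \<le> x" and "x \<le> x_beta"
  shows "mid 1 x > 0" and "mid 2 x < 0"
proof -
  have "a x > c" "a x > 0"
    using a_on_middle(1)[OF assms] c_less_alpha alpha_pos by auto
  then show "mid 1 x > 0" and "mid 2 x < 0"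
    unfolding mid_def using dV_alpha_pos c_less_alpha sigma_pos mu_pos
    by (auto simp: mult_pos_neg mult_neg_pos)
qed

lemma high_1_pos: "high 1 x > 0"
proof -
  have "r_plus \<beta> > 0" "r_minus \<beta> < rt_minus \<beta>" "rt_minus \<beta> < 0"
    using beta_pos by (auto intro: r_plus_pos rt_minus_neg r_minus_less_rt_minus)
  then show ?thesis
    by (simp add: high_eq[of 1, simplified] add_pos_pos)
qed

text \<open>\<open>high 2\<close> is nondecreasing and reaches the negative number \<open>rt_minus \<beta>\<close> at \<open>x_1\<close>.\<close>

lemma high_2_neg:
  assumes "x \<le> x_1"
  shows "high 2 x < 0"
proof -
  have signs: "r_plus \<beta> > 0" "r_minus \<beta> < rt_minus \<beta>" "rt_minus \<beta> < 0" "r_minus \<beta> < 0"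
    using beta_pos by (auto intro: r_plus_pos rt_minus_neg r_minus_less_rt_minus r_minus_neg)
  have eq: "high 2 x =
    ((rt_minus \<beta> - r_minus \<beta>) * r_plus \<beta> * exp (r_plus \<beta> * (x - x_1))
     - (r_plus \<beta> - rt_minus \<beta>) * (- r_minus \<beta>) * exp (r_minus \<beta> * (x - x_1)))
    / (r_plus \<beta> - r_minus \<beta>)" for x
    by (simp add: high_eq[of 2])
  have "(r_plus \<beta> - rt_minus \<beta>) * (- r_minus \<beta>) \<ge> 0"
    using signs by (intro mult_nonneg_nonneg) auto
  then have "high 2 x \<le> high 2 x_1"
    unfolding eq using signs assms by (intro divide_right_mono exp_diff_mono) auto
  also have "\<dots> < 0"
    using match_x_1[of 2] payout_x_1 signs by simp
  finally show ?thesis .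
qed

lemma high_drift_nonneg:
  assumes "x_beta \<le> x"
  shows "\<mu> * high 1 x + \<sigma>\<^sup>2 * \<beta> * high 2 x \<ge> 0"
proof -
  have "\<mu> * high 1 x_beta + \<sigma>\<^sup>2 * \<beta> * high 2 x_beta \<le> \<mu> * high 1 x + \<sigma>\<^sup>2 * \<beta> * high 2 x"
    unfolding high_drift
    using Delta_weights(1,2) r_plus_pos[OF beta_pos] r_minus_neg[OF beta_pos] assms
    by (intro divide_right_mono exp_diff_mono) auto
  then show ?thesis
    unfolding high_drift_x_beta .
qed

lemma payout_eq:
  "payout 1 x = exp (rt_minus \<beta> * (x - x_1))"
  "payout 2 x = rt_minus \<beta> * exp (rt_minus \<beta> * (x - x_1))"
  using rt_minus_neg[OF beta_pos] by (simp_all add: payout_def power2_eq_square)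

lemma payout_drift_pos: "\<mu> * payout 1 x + \<sigma>\<^sup>2 * \<beta> * payout 2 x > 0"
proof -
  have "\<mu> * payout 1 x + \<sigma>\<^sup>2 * \<beta> * payout 2 x
      = (\<mu> + \<beta> * \<sigma>\<^sup>2 * rt_minus \<beta>) * exp (rt_minus \<beta> * (x - x_1))"
    unfolding payout_eq by (simp add: algebra_simps)
  then show ?thesis
    using rt_minus_drift_pos by simp
qed

lemma W_1_pos: "W 1 x > 0"
  using low_1_pos mid_signs(1) high_1_pos by (auto simp: W_def payout_eq[unfolded One_nat_def])

lemma W_2_neg: "W 2 x < 0"
  using low_2_neg mid_signs(2) high_2_neg rt_minus_neg[OF beta_pos]
  by (auto simp: W_def payout_eq mult_neg_pos)

lemma W_1_antimono: "x \<le> y \<Longrightarrow> W 1 y \<le> W 1 x"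
  using DERIV_W[of 1] W_2_neg
  by (intro DERIV_nonpos_imp_nonincreasing[of x y "W 1"])
    (auto simp: numeral_2_eq_2 intro: less_imp_le)

lemma V_mono: "x \<le> y \<Longrightarrow> V x \<le> V y"
  using DERIV_W[of 0] W_1_pos unfolding W_0
  by (intro DERIV_nonneg_imp_nondecreasing[of x y V]) (auto intro: less_imp_le)

text \<open>
  As \<open>V'\<close> is decreasing, the payout term is zero to the left of \<open>x_1\<close> and equals
  \<open>M (1 - V')\<close> to the right of it.
\<close>

lemma W_1_x_1: "W 1 x_1 = 1"
  using x_alpha_less_x_beta x_beta_less_x_1 payout_x_1 by (simp add: W_def)

lemma optimal_control:
  obtains b where "b \<in> {\<alpha>..\<beta>}"
    and "\<And>u. u \<in> {\<alpha>..\<beta>} \<Longrightarrow> (u - b) * (\<mu> * W 1 x + \<sigma>\<^sup>2 * b * W 2 x) \<le> 0"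
    and "1 / 2 * \<sigma>\<^sup>2 * b\<^sup>2 * W 2 x + (b * \<mu> - \<delta>) * W 1 x - \<gamma> * W 0 x + M * max (1 - W 1 x) 0 = 0"
proof -
  note order = x_alpha_less_x_beta x_beta_less_x_1
  have no_payout: "max (1 - W 1 x) 0 = 0" if "x < x_1"
    using W_1_antimono[of x x_1] W_1_x_1 that by simp
  consider "x < x_alpha" | "x_alpha \<le> x" "x < x_beta" | "x_beta \<le> x" "x < x_1" | "x_1 \<le> x"
    by linarith
  then show ?thesis
  proof cases
    case 1
    then have W: "W n x = low n x" for n
      by (simp add: W_def)
    show ?thesis
    proof (rule that[of \<alpha>])
      show "(u - \<alpha>) * (\<mu> * W 1 x + \<sigma>\<^sup>2 * \<alpha> * W 2 x) \<le> 0" if "u \<in> {\<alpha>..\<beta>}" for u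
        unfolding W using that low_drift_nonpos[of x] 1 by (intro mult_nonneg_nonpos) auto
    qed (use 1 order alpha_less_beta no_payout low_ode[of x] in \<open>auto simp: W\<close>)
  next
    case 2
    then have W: "W n x = mid n x" for n
      by (simp add: W_def)
    have a: "\<alpha> \<le> a x" "a x \<le> \<beta>"
      using a_on_middle 2 by auto
    then have "a x > 0"
      using alpha_pos by simp
    then show ?thesis
      using that[of "a x"] a 2 order no_payout mid_second[of x] mid_ode[of x] by (simp add: W)
  next
    case 3
    then have W: "W n x = high n x" for n
      using order by (simp add: W_def)
    show ?thesis
    proof (rule that[of \<beta>])
      show "(u - \<beta>) * (\<mu> * W 1 x + \<sigma>\<^sup>2 * \<beta> * W 2 x) \<le> 0" if "u \<in> {\<alpha>..\<beta>}" for u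
        unfolding W using that high_drift_nonneg[of x] 3 by (intro mult_nonpos_nonneg) auto
    qed (use 3 alpha_less_beta no_payout high_ode[of x] in \<open>auto simp: W\<close>)
  next
    case 4
    then have W: "W n x = payout n x" for n
      using order by (simp add: W_def)
    have "payout 1 x \<le> 1"
      using W_1_antimono[of x_1 x] W_1_x_1 4 W[of 1] by simp
    then have max: "max (1 - payout 1 x) 0 = 1 - payout 1 x"
      by simp
    show ?thesis
    proof (rule that[of \<beta>])
      show "(u - \<beta>) * (\<mu> * W 1 x + \<sigma>\<^sup>2 * \<beta> * W 2 x) \<le> 0" if "u \<in> {\<alpha>..\<beta>}" for u
        unfolding W using that payout_drift_pos[of x] by (intro mult_nonpos_nonneg) auto
      show "1 / 2 * \<sigma>\<^sup>2 * \<beta>\<^sup>2 * W 2 x + (\<beta> * \<mu> - \<delta>) * W 1 x - \<gamma> * W 0 x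
          + M * max (1 - W 1 x) 0 = 0"
        unfolding W max by (rule payout_ode)
    qed (use alpha_less_beta in auto)
  qed
qed

lemma W_hjb:
  "is_max_on (\<lambda>u. 1 / 2 * \<sigma>\<^sup>2 * u\<^sup>2 * W 2 x + (u * \<mu> - \<delta>) * W 1 x - \<gamma> * V x
     + M * max (1 - W 1 x) 0) {\<alpha>..\<beta>} 0"
proof -
  let ?k = "- \<delta> * W 1 x - \<gamma> * V x + M * max (1 - W 1 x) 0"
  have split: "1 / 2 * \<sigma>\<^sup>2 * u\<^sup>2 * W 2 x + (u * \<mu> - \<delta>) * W 1 x - \<gamma> * V x + M * max (1 - W 1 x) 0
      = 1 / 2 * \<sigma>\<^sup>2 * u\<^sup>2 * W 2 x + u * (\<mu> * W 1 x) + ?k" for u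
    by (simp add: algebra_simps)
  obtain b where b: "b \<in> {\<alpha>..\<beta>}"
      "\<And>u. u \<in> {\<alpha>..\<beta>} \<Longrightarrow> (u - b) * (\<mu> * W 1 x + \<sigma>\<^sup>2 * b * W 2 x) \<le> 0"
    and zero: "1 / 2 * \<sigma>\<^sup>2 * b\<^sup>2 * W 2 x + (b * \<mu> - \<delta>) * W 1 x - \<gamma> * V x
      + M * max (1 - W 1 x) 0 = 0"
    using optimal_control[of x] unfolding W_0 by blast
  have "1 / 2 * \<sigma>\<^sup>2 * u\<^sup>2 * W 2 x + (u * \<mu> - \<delta>) * W 1 x - \<gamma> * V x + M * max (1 - W 1 x) 0 \<le> 0"
    if "u \<in> {\<alpha>..\<beta>}" for u
    using concave_quadratic_le[of "\<sigma>\<^sup>2" "W 2 x" u b "\<mu> * W 1 x" ?k] W_2_neg[of x] b(2)[OF that]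
    unfolding split[symmetric] zero by simp
  then show ?thesis
    unfolding is_max_on_def using b(1) zero by blast
qed

lemma V_0: "V 0 = 0"
  using x_alpha_pos by (simp add: V_def)

lemma V_le: "V x \<le> M / \<gamma>"
proof -
  have "V x \<le> V (max x x_1)"
    by (intro V_mono) simp
  also have "\<dots> \<le> M / \<gamma>"
    using x_alpha_less_x_beta x_beta_less_x_1 rt_minus_neg[OF beta_pos]
    by (simp add: V_def divide_nonneg_neg)
  finally show ?thesis .
qed

end

section \<open>The solution of the HJB equation\<close>

theorem theorem3p8:
  fixes \<mu> \<sigma> \<gamma> \<delta> M \<alpha> \<beta> :: real and V :: "real \<Rightarrow> real"
  assumes "\<mu> > 0" and "\<sigma> > 0" and "\<gamma> > 0" and "\<delta> \<ge> 0" and "M > 0"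
    and "0 < \<alpha>" and "\<alpha> < \<beta>"
    and "2 * \<delta> / \<mu> < \<alpha>"
    and "M > hjb_constants.M_beta \<mu> \<sigma> \<gamma> \<delta> \<beta>"
    and "V = hjb_constants.V \<mu> \<sigma> \<gamma> \<delta> M \<alpha> \<beta>"
  shows "concave_on {0..} V \<and>
    (\<exists>V' V''. \<forall>x\<ge>0.
       (V has_real_derivative V' x) (at x within {0..}) \<and>
       (V' has_real_derivative V'' x) (at x within {0..}) \<and>
       is_max_on
         (\<lambda>a. 1 / 2 * \<sigma>\<^sup>2 * a\<^sup>2 * V'' x + (a * \<mu> - \<delta>) * V' x - \<gamma> * V x + M * max (1 - V' x) 0)
         {\<alpha>..\<beta>} 0) \<and>
    V 0 = 0 \<and>
    (\<forall>x>0. 0 \<le> V x \<and> V x \<le> M / \<gamma>)"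
proof -
  interpret hjb_problem \<mu> \<sigma> \<gamma> \<delta> M \<alpha> \<beta>
    using assms by unfold_locales auto
  have V: "V = hjb_constants.V \<mu> \<sigma> \<gamma> \<delta> M \<alpha> \<beta>"
    by fact
  have d1: "DERIV V x :> W 1 x" for x
    using DERIV_W[of 0 x] unfolding W_0 V by simp
  have d2: "DERIV (W 1) x :> W 2 x" for x
    using DERIV_W[of 1 x] by (simp add: numeral_2_eq_2)
  have "concave_on {0..} V"
    using d1 d2 W_2_neg by (intro f''_le0_imp_concave[of _ V "W 1" "W 2"]) (auto intro: less_imp_le)
  moreover have "V 0 = 0"
    unfolding V by (rule V_0)
  moreover have "0 \<le> V x \<and> V x \<le> M / \<gamma>" if "x > 0" for x
    using V_mono[of 0 x] V_0 V_le[of x] that unfolding V by simp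
  moreover have "is_max_on (\<lambda>a. 1 / 2 * \<sigma>\<^sup>2 * a\<^sup>2 * W 2 x + (a * \<mu> - \<delta>) * W 1 x - \<gamma> * V x
      + M * max (1 - W 1 x) 0) {\<alpha>..\<beta>} 0" for x
    unfolding V by (rule W_hjb)
  ultimately show ?thesis
    using d1 d2 by (blast intro: has_field_derivative_at_within)
qed

end
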